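(* Let $D_x,\Delta_{\mathrm t,\mathrm s},\Delta_{\mathrm r,\mathrm s},\alpha,P,\eta,\sigma_{\mathrm s}>0$ and let the target have $x$-coordinate $x_{\mathrm s}=D_x/2$. For odd positive integers $N,M$ let $$\gamma_{\mathrm{SWAN}}^{(\mathrm{SM})}(N,M)=\max_{\mathbf x_{\mathrm t},\mathbf x_{\mathrm r}}\ \frac{\alpha P\eta^4}{\sigma_{\mathrm s}^2}\left(\sum_{n=1}^N\frac{1}{(x_{\mathrm t,n}-x_{\mathrm s})^2+\Delta_{\mathrm t,\mathrm s}^2}\right)\left(\sum_{m=1}^M\frac{1}{(x_{\mathrm r,m}-x_{\mathrm s})^2+\Delta_{\mathrm r,\mathrm s}^2}\right),$$ the maximum being over all $x_{\mathrm t,n}\in[(n-1)D_x/N,\,nD_x/N]$, $1\le n\le N$, and $x_{\mathrm r,m}\in[(m-1)D_x/M,\,mD_x/M]$, $1\le m\le M$. Let $\gamma_{\mathrm{PASS}}^{(\mathrm{SM})}=\frac{\alpha P\eta^4}{\sigma_{\mathrm s}^2\Delta_{\mathrm t,\mathrm s}^2\Delta_{\mathrm r,\mathrm s}^2}$ and $\eta^{(\mathrm{SM})}(N,M)=\gamma_{\mathrm{SWAN}}^{(\mathrm{SM})}(N,M)/\gamma_{\mathrm{PASS}}^{(\mathrm{SM})}$. Write $L_{\mathrm t}=D_x/N$ and $L_{\mathrm r}=D_x/M$. Then, as $N,M\to\infty$ through odd integers, $$\eta^{(\mathrm{SM})}(N,M)\simeq\left(1+\frac{2\Delta_{\mathrm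 r,\mathrm s}}{L_{\mathrm r}}\tan^{-1}\!\Big(\frac{D_x}{2\Delta_{\mathrm r,\mathrm s}}\Big)\right)\left(1+\frac{2\Delta_{\mathrm t,\mathrm s}}{L_{\mathrm t}}\tan^{-1}\!\Big(\frac{D_x}{2\Delta_{\mathrm t,\mathrm s}}\Big)\right),$$ in the sense that the ratio of the two sides tends to $1$.
   Context: Transmit and receive waveguides of length $D_x$ are split into $N$ and $M$ equal segments, each carrying one pinching antenna, at $x$-coordinates $x_{\mathrm t,n}$ and $x_{\mathrm r,m}$. $\Delta_{\mathrm t,\mathrm s}$ and $\Delta_{\mathrm r,\mathrm s}$ are the distances from the target to the transmit and receive waveguide lines. Under segment multiplexing (one RF chain per segment) with maximum-ratio transmission and combining and in-waveguide loss neglected, the sensing SNR is the expression being maximized in the claim. $\gamma_{\mathrm{PASS}}^{(\mathrm{SM})}$ is the SNR of the unsegmented system. The constant $\eta$ inside $\eta^4$ is a free-space channel constant, distinct from the gain $\eta^{(\mathrm{SM})}$. *)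

theory Defs
  imports "HOL-Analysis.Analysis"
begin

text \<open>Admissible antenna positions: the waveguide \<open>[0, D]\<close> is cut into \<open>K\<close> equal segments, and
  antenna \<open>k\<close> (for \<open>1 \<le> k \<le> K\<close>) lies in the \<open>k\<close>-th one.\<close>

definition segment_positions :: "real \<Rightarrow> nat \<Rightarrow> (nat \<Rightarrow> real) set" where
  "segment_positions D K =
     (\<Pi>\<^sub>E k\<in>{1..K}. {(real k - 1) * D / real K .. real k * D / real K})"

definition sensing_snr_SM ::
  "real \<Rightarrow> real \<Rightarrow> real \<Rightarrow> real \<Rightarrow> real \<Rightarrow> real \<Rightarrow> real \<Rightarrow> nat \<Rightarrow> nat \<Rightarrow>
   (nat \<Rightarrow> real) \<Rightarrow> (nat \<Rightarrow> real) \<Rightarrow> real" where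
  "sensing_snr_SM \<alpha> P \<eta> \<sigma> \<Delta>t \<Delta>r xs N M xt xr =
     \<alpha> * P * \<eta> ^ 4 / \<sigma>\<^sup>2
       * (\<Sum>n=1..N. 1 / ((xt n - xs)\<^sup>2 + \<Delta>t\<^sup>2))
       * (\<Sum>m=1..M. 1 / ((xr m - xs)\<^sup>2 + \<Delta>r\<^sup>2))"

text \<open>\<open>GREATEST\<close> is the attained maximum; it is unspecified if no greatest value exists, so
  anything proved about it depends on attainment.\<close>

definition gamma_SWAN_SM ::
  "real \<Rightarrow> real \<Rightarrow> real \<Rightarrow> real \<Rightarrow> real \<Rightarrow> real \<Rightarrow> real \<Rightarrow> real \<Rightarrow> nat \<Rightarrow> nat \<Rightarrow> real" where
  "gamma_SWAN_SM \<alpha> P \<eta> \<sigma> \<Delta>t \<Delta>r D xs N M =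
     (GREATEST \<gamma>. \<exists>xt \<in> segment_positions D N. \<exists>xr \<in> segment_positions D M.
        \<gamma> = sensing_snr_SM \<alpha> P \<eta> \<sigma> \<Delta>t \<Delta>r xs N M xt xr)"

definition gamma_PASS_SM :: "real \<Rightarrow> real \<Rightarrow> real \<Rightarrow> real \<Rightarrow> real \<Rightarrow> real \<Rightarrow> real" where
  "gamma_PASS_SM \<alpha> P \<eta> \<sigma> \<Delta>t \<Delta>r = \<alpha> * P * \<eta> ^ 4 / (\<sigma>\<^sup>2 * \<Delta>t\<^sup>2 * \<Delta>r\<^sup>2)"

text \<open>The gain of the segmented over the unsegmented system; the argument \<open>\<eta>\<close> is the free-space
  channel constant.\<close>

definition gain_SM ::
  "real \<Rightarrow> real \<Rightarrow> real \<Rightarrow> real \<Rightarrow> real \<Rightarrow> real \<Rightarrow> real \<Rightarrow> real \<Rightarrow> nat \<Rightarrow> nat \<Rightarrow> real" where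
  "gain_SM \<alpha> P \<eta> \<sigma> \<Delta>t \<Delta>r D xs N M =
     gamma_SWAN_SM \<alpha> P \<eta> \<sigma> \<Delta>t \<Delta>r D xs N M / gamma_PASS_SM \<alpha> P \<eta> \<sigma> \<Delta>t \<Delta>r"

end

(* The objective is a product of two nonnegative factors, each a sum over segments, so the maximum
   is reached by maximizing the kernel f(x) = 1 / ((x - xs)^2 + d^2) on every segment separately.
   D / N times the maximal sum is then a tagged Riemann sum of f, and it converges to
   (2 / d) arctan (D / (2 d)). The convergence needs no integration theory: with a primitive F of f,
   the mean value theorem on each segment writes F D - F 0 itself as a tagged Riemann sum, and two
   tagged Riemann sums differ by at most D times the oscillation of f on a segment. *)

theory Submission
  imports Defs
begin

lemma segment_subset:
  fixes D :: real
  assumes "D > 0" "k \<in> {1..K}"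
  shows "{(real k - 1) * D / real K .. real k * D / real K} \<subseteq> {0..D}"
proof -
  have "0 \<le> (real k - 1) * D / real K"
    using assms by (auto intro!: divide_nonneg_nonneg mult_nonneg_nonneg)
  moreover have "real k * D / real K \<le> D"
    using assms by (simp add: divide_le_eq mult.commute)
  ultimately show ?thesis by auto
qed

text \<open>The tags are arbitrary, so the maximizing positions need never be computed. The
  derivative of \<open>F\<close> is two-sided even at 0 and \<open>D\<close>, as the mean value
  theorem is applied on closed segments.\<close>

lemma riemann_sum_tendsto:
  fixes f F :: "real \<Rightarrow> real"
  assumes D: "D > 0"
    and cont: "continuous_on {0..D} f"
    and deriv: "\<And>x. x \<in> {0..D} \<Longrightarrow> (F has_real_derivative f x) (at x)"
    and pos: "\<And>N. X N \<in> segment_positions D N"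
  shows "(\<lambda>N. D / real N * (\<Sum>k=1..N. f (X N k))) \<longlonglongrightarrow> F D - F 0"
proof (rule LIMSEQ_I)
  fix e :: real
  assume e: "e > 0"
  \<comment> \<open>The tolerance \<open>e / (2 * D)\<close> is chosen so that \<open>N\<close>
    errors weighted by \<open>D / real N\<close> add up to \<open>e / 2\<close>, which leaves room
    for the strict bound.\<close>
  have "uniformly_continuous_on {0..D} f"
    using cont by (simp add: compact_uniformly_continuous)
  then obtain d where d: "d > 0" and
    osc: "\<And>x y. x \<in> {0..D} \<Longrightarrow> y \<in> {0..D} \<Longrightarrow> \<bar>x - y\<bar> < d \<Longrightarrow> \<bar>f x - f y\<bar> < e / (2 * D)"
    using e D unfolding uniformly_continuous_on_def dist_real_def
    by (metis divide_pos_pos mult_pos_pos zero_less_numeral)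
  obtain n0 :: nat where n0: "D / d < real n0"
    using reals_Archimedean2 by blast
  show "\<exists>no. \<forall>N\<ge>no. norm (D / real N * (\<Sum>k=1..N. f (X N k)) - (F D - F 0)) < e"
  proof (intro exI allI impI)
    fix N assume N: "N \<ge> Suc n0"
    hence N0: "real N > 0" by simp
    have "D / d < real N"
      using n0 N by simp
    hence mesh: "D / real N < d"
      using d N0 by (simp add: field_simps)
    define p where "p k = real k * D / real N" for k :: nat
    \<comment> \<open>\<open>k - 1\<close> is a natural number inside \<open>p\<close> and agrees
      with \<open>real k - 1\<close> because \<open>k\<close> is at least 1.\<close>
    have step: "p k - p (k - 1) = D / real N" and seg: "(real k - 1) * D / real N = p (k - 1)"
      if "k \<in> {1..N}" for k
      using that by (simp_all add: p_def of_nat_diff algebra_simps diff_divide_distrib)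
    have term_bound: "\<bar>D / real N * f (X N k) - (F (p k) - F (p (k - 1)))\<bar> \<le> D / real N * (e / (2 * D))"
      if k: "k \<in> {1..N}" for k
    proof -
      have sub: "{p (k - 1) .. p k} \<subseteq> {0..D}"
        using segment_subset[OF D k] seg[OF k] by (simp add: p_def)
      have lt: "p (k - 1) < p k"
        using step[OF k] D N0 by (smt (verit) divide_pos_pos)
      have Xk: "X N k \<in> {p (k - 1) .. p k}"
        using pos[of N] k seg[OF k] unfolding segment_positions_def p_def
        by (metis (lifting) PiE_mem)
      \<comment> \<open>The mean value point \<open>z\<close> is the tag at which the Riemann
        summand equals the increment of \<open>F\<close> exactly; it shares a segment of length
        below \<open>d\<close> with \<open>X N k\<close>.\<close>
      have "\<exists>z>p (k - 1). z < p k \<and> F (p k) - F (p (k - 1)) = (p k - p (k - 1)) * f z"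
        using lt sub by (intro MVT2) (auto intro!: deriv)
      then obtain z where z: "p (k - 1) < z" "z < p k"
        and Fz: "F (p k) - F (p (k - 1)) = D / real N * f z"
        using step[OF k] by auto
      have "\<bar>X N k - z\<bar> < d"
        using Xk z mesh step[OF k] by (auto simp: abs_less_iff)
      hence "\<bar>f (X N k) - f z\<bar> < e / (2 * D)"
        using Xk z sub by (intro osc) auto
      moreover have "D / real N * f (X N k) - D / real N * f z = D / real N * (f (X N k) - f z)"
        by (simp add: algebra_simps)
      ultimately show ?thesis
        unfolding Fz using D by (simp only: abs_mult) (intro mult_mono; simp)
    qed
    have "(\<Sum>k=1..N. F (p k) - F (p (k - 1))) = F (p N) - F (p 0)"
      using sum_telescope''[of 0 N "\<lambda>k. F (p k)"] by simp
    hence tele: "(\<Sum>k=1..N. F (p k) - F (p (k - 1))) = F D - F 0"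
      using N0 by (simp add: p_def)
    have "\<bar>D / real N * (\<Sum>k=1..N. f (X N k)) - (F D - F 0)\<bar>
        = \<bar>\<Sum>k=1..N. D / real N * f (X N k) - (F (p k) - F (p (k - 1)))\<bar>"
      unfolding tele[symmetric] by (simp only: sum_distrib_left sum_subtractf)
    also have "\<dots> \<le> (\<Sum>k=1..N. D / real N * (e / (2 * D)))"
      by (rule order_trans[OF sum_abs sum_mono[OF term_bound]])
    also have "\<dots> = e / 2"
      using N0 D by simp
    also have "\<dots> < e" using e by simp
    finally show "norm (D / real N * (\<Sum>k=1..N. f (X N k)) - (F D - F 0)) < e" by simp
  qed
qed

text \<open>The segments impose independent constraints, so maximizing \<open>f\<close> on each
  compact segment maximizes the sum. A single family \<open>X\<close> covers all \<open>K\<close>,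
  ready to serve as tags in a limit.\<close>

lemma segment_maximizers_exist:
  fixes f :: "real \<Rightarrow> real"
  assumes D: "D > 0" and cont: "continuous_on {0..D} f"
  obtains X where "\<And>K. X K \<in> segment_positions D K"
    and "\<And>K y. y \<in> segment_positions D K \<Longrightarrow> (\<Sum>k=1..K. f (y k)) \<le> (\<Sum>k=1..K. f (X K k))"
proof -
  let ?I = "\<lambda>K k. {(real k - 1) * D / real K .. real k * D / real K}"
  define g where "g K k = (SOME x. x \<in> ?I K k \<and> (\<forall>y\<in>?I K k. f y \<le> f x))" for K k :: nat
  have g: "g K k \<in> ?I K k \<and> (\<forall>y\<in>?I K k. f y \<le> f (g K k))" if k: "k \<in> {1..K}" for K k
    unfolding g_def
  proof (rule someI_ex, unfold Bex_def[symmetric], rule continuous_attains_sup)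
    show "?I K k \<noteq> {}"
      using D by (simp add: divide_right_mono mult_right_mono)
    show "continuous_on (?I K k) f"
      using cont segment_subset[OF D k] by (rule continuous_on_subset)
  qed simp
  show ?thesis
  \<comment> \<open>\<open>segment_positions\<close> is an extensional product, so the chosen
    maximizers must be \<open>undefined\<close> outside \<open>{1..K}\<close>.\<close>
  proof (rule that[of "\<lambda>K. restrict (g K) {1..K}"])
    show "restrict (g K) {1..K} \<in> segment_positions D K" for K
      unfolding segment_positions_def using g by (simp add: restrict_PiE_iff)
    show "(\<Sum>k=1..K. f (y k)) \<le> (\<Sum>k=1..K. f (restrict (g K) {1..K} k))"
      if "y \<in> segment_positions D K" for K y
    proof (rule sum_mono)
      fix k assume k: "k \<in> {1..K}"
      hence "y k \<in> ?I K k"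
        using that unfolding segment_positions_def by (metis (lifting) PiE_mem)
      thus "f (y k) \<le> f (restrict (g K) {1..K} k)"
        using g[OF k] k by simp
    qed
  qed
qed

definition path_gain :: "real \<Rightarrow> real \<Rightarrow> real \<Rightarrow> real" where
  "path_gain \<Delta> xs x = 1 / ((x - xs)\<^sup>2 + \<Delta>\<^sup>2)"

lemma path_gain_nonneg: "path_gain \<Delta> xs x \<ge> 0"
  by (simp add: path_gain_def)

lemma continuous_on_path_gain:
  assumes "\<Delta> > 0"
  shows "continuous_on S (path_gain \<Delta> xs)"
proof -
  have "(x - xs)\<^sup>2 + \<Delta>\<^sup>2 \<noteq> 0" for x
    using assms by (simp add: sum_power2_eq_zero_iff)
  thus ?thesis
    unfolding path_gain_def by (intro continuous_intros) auto
qed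

lemma has_real_derivative_path_gain_primitive:
  assumes "\<Delta> > 0"
  shows "((\<lambda>x. arctan ((x - xs) / \<Delta>) / \<Delta>) has_real_derivative path_gain \<Delta> xs x) (at x)"
proof -
  have "\<Delta> * \<Delta> * (1 + ((x - xs) / \<Delta>)\<^sup>2) = (x - xs)\<^sup>2 + \<Delta>\<^sup>2"
    using assms by (simp add: power2_eq_square distrib_left)
  hence "inverse (1 + ((x - xs) / \<Delta>)\<^sup>2) / \<Delta> / \<Delta> = path_gain \<Delta> xs x"
    by (simp add: path_gain_def divide_inverse flip: inverse_mult_distrib) (simp add: ac_simps)
  moreover have "((\<lambda>x. (x - xs) / \<Delta>) has_real_derivative 1 / \<Delta>) (at x)"
    by (intro DERIV_cdivide) (auto intro!: derivative_eq_intros)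
  ultimately show ?thesis
    using DERIV_cdivide[OF DERIV_chain2[OF DERIV_arctan], of "\<lambda>x. (x - xs) / \<Delta>" "1 / \<Delta>" x UNIV \<Delta>]
    by simp
qed

text \<open>Multiplying numerator and denominator by \<open>D / real N\<close> turns the numerator
  into a Riemann sum and the summand 1 into a null sequence; both then tend to
  \<open>2 * \<Delta> * arctan (D / (2 * \<Delta>))\<close>.\<close>

lemma normalized_gain_tendsto_1:
  fixes D \<Delta> :: real
  assumes D: "D > 0" and \<Delta>: "\<Delta> > 0"
    and pos: "\<And>N. X N \<in> segment_positions D N"
  shows "(\<lambda>N. \<Delta>\<^sup>2 * (\<Sum>k=1..N. path_gain \<Delta> (D / 2) (X N k)) /
            (1 + 2 * \<Delta> / (D / real N) * arctan (D / (2 * \<Delta>)))) \<longlonglongrightarrow> 1"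
proof -
  let ?a = "arctan (D / (2 * \<Delta>))"
  let ?S = "\<lambda>N. \<Sum>k=1..N. path_gain \<Delta> (D / 2) (X N k)"
  have a: "?a > 0" using D \<Delta> by simp
  have "(\<lambda>N. D / real N * ?S N) \<longlonglongrightarrow>
      arctan ((D - D / 2) / \<Delta>) / \<Delta> - arctan ((0 - D / 2) / \<Delta>) / \<Delta>"
    using has_real_derivative_path_gain_primitive[OF \<Delta>]
    by (intro riemann_sum_tendsto D continuous_on_path_gain \<Delta> pos)
  \<comment> \<open>With the target at the midpoint the two endpoint arguments are opposite, and
    arctan is an odd function.\<close>
  moreover have "arctan ((D - D / 2) / \<Delta>) / \<Delta> - arctan ((0 - D / 2) / \<Delta>) / \<Delta> = 2 * ?a / \<Delta>"
    by (simp add: arctan_minus)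
  ultimately have S: "(\<lambda>N. D / real N * ?S N) \<longlonglongrightarrow> 2 * ?a / \<Delta>" by simp
  have "(\<lambda>N. \<Delta>\<^sup>2 * (D / real N * ?S N) / (D / real N + 2 * \<Delta> * ?a)) \<longlonglongrightarrow>
      \<Delta>\<^sup>2 * (2 * ?a / \<Delta>) / (0 + 2 * \<Delta> * ?a)"
    using D \<Delta> by (intro tendsto_intros S lim_const_over_n) simp
  moreover have "\<Delta>\<^sup>2 * (2 * ?a / \<Delta>) / (0 + 2 * \<Delta> * ?a) = 1"
    using D \<Delta> by (simp add: power2_eq_square)
  \<comment> \<open>The common factor \<open>D / real N\<close> is cancelled only for positive
    \<open>N\<close>, since it is 0 at \<open>N = 0\<close>.\<close>
  moreover have "\<forall>\<^sub>F N in sequentially. \<Delta>\<^sup>2 * (D / real N * ?S N) / (D / real N + 2 * \<Delta> * ?a) =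
      \<Delta>\<^sup>2 * ?S N / (1 + 2 * \<Delta> / (D / real N) * ?a)"
    using eventually_gt_at_top[of 0]
  proof eventually_elim
    case (elim N)
    have "D / real N \<noteq> 0" using D elim by simp
    moreover from this have "D / real N + 2 * \<Delta> * ?a = D / real N * (1 + 2 * \<Delta> / (D / real N) * ?a)"
      using elim by (simp add: distrib_left)
    moreover have "\<Delta>\<^sup>2 * (D / real N * ?S N) = D / real N * (\<Delta>\<^sup>2 * ?S N)"
      by (simp only: ac_simps)
    ultimately show ?case by (simp only: mult_divide_mult_cancel_left not_False_eq_True)
  qed
  ultimately show ?thesis by (auto intro: Lim_transform_eventually)
qed

text \<open>Both sums are nonnegative, so maximizing each one maximizes their product. Dividing by
  the unsegmented SNR cancels the channel constants and leaves one squared distance for each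
  waveguide.\<close>

lemma gain_SM_eq:
  fixes \<Delta>t \<Delta>r \<alpha> P \<eta> \<sigma> :: real
  assumes pos: "\<Delta>t > 0" "\<Delta>r > 0" "\<alpha> > 0" "P > 0" "\<eta> > 0" "\<sigma> > 0"
    and x: "x \<in> segment_positions D N"
    and x_max: "\<And>y. y \<in> segment_positions D N \<Longrightarrow>
      (\<Sum>k=1..N. path_gain \<Delta>t xs (y k)) \<le> (\<Sum>k=1..N. path_gain \<Delta>t xs (x k))"
    and z: "z \<in> segment_positions D M"
    and z_max: "\<And>y. y \<in> segment_positions D M \<Longrightarrow>
      (\<Sum>k=1..M. path_gain \<Delta>r xs (y k)) \<le> (\<Sum>k=1..M. path_gain \<Delta>r xs (z k))"
  shows "gain_SM \<alpha> P \<eta> \<sigma> \<Delta>t \<Delta>r D xs N M =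
    (\<Delta>t\<^sup>2 * (\<Sum>k=1..N. path_gain \<Delta>t xs (x k))) * (\<Delta>r\<^sup>2 * (\<Sum>k=1..M. path_gain \<Delta>r xs (z k)))"
proof -
  have snr: "sensing_snr_SM \<alpha> P \<eta> \<sigma> \<Delta>t \<Delta>r xs N M u v = \<alpha> * P * \<eta> ^ 4 / \<sigma>\<^sup>2 *
      (\<Sum>k=1..N. path_gain \<Delta>t xs (u k)) * (\<Sum>k=1..M. path_gain \<Delta>r xs (v k))" for u v
    by (simp add: sensing_snr_SM_def path_gain_def)
  have "gamma_SWAN_SM \<alpha> P \<eta> \<sigma> \<Delta>t \<Delta>r D xs N M = sensing_snr_SM \<alpha> P \<eta> \<sigma> \<Delta>t \<Delta>r xs N M x z"
    unfolding gamma_SWAN_SM_def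
  \<comment> \<open>Attainment at \<open>x\<close> and \<open>z\<close> is what gives
    \<open>GREATEST\<close> a determined value; the upper bound comes from monotonicity of products
    of nonnegative factors.\<close>
  proof (rule Greatest_equality)
    fix \<gamma> assume "\<exists>xt \<in> segment_positions D N. \<exists>xr \<in> segment_positions D M.
        \<gamma> = sensing_snr_SM \<alpha> P \<eta> \<sigma> \<Delta>t \<Delta>r xs N M xt xr"
    then obtain u v where "u \<in> segment_positions D N" "v \<in> segment_positions D M"
      and \<gamma>: "\<gamma> = sensing_snr_SM \<alpha> P \<eta> \<sigma> \<Delta>t \<Delta>r xs N M u v" by blast
    moreover have "\<alpha> * P * \<eta> ^ 4 / \<sigma>\<^sup>2 \<ge> 0" using pos by simp
    ultimately show "\<gamma> \<le> sensing_snr_SM \<alpha> P \<eta> \<sigma> \<Delta>t \<Delta>r xs N M x z"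
      unfolding \<gamma> snr
      by (intro mult_mono order_refl mult_nonneg_nonneg sum_nonneg path_gain_nonneg x_max z_max)
  qed (use x z in blast)
  thus ?thesis
    using pos by (simp add: gain_SM_def gamma_PASS_SM_def snr)
qed

text \<open>The quotient splits into a function of \<open>N\<close> times a function of
  \<open>M\<close>, so two one-variable limits yield the joint limit, with no relation imposed
  between the growth of \<open>N\<close> and \<open>M\<close>.\<close>

theorem mainTheorem3:
  fixes D \<Delta>t \<Delta>r \<alpha> P \<eta> \<sigma> xs :: real
  assumes "D > 0" and "\<Delta>t > 0" and "\<Delta>r > 0" and "\<alpha> > 0" and "P > 0" and "\<eta> > 0" and "\<sigma> > 0"
    and "xs = D / 2"
  shows "((\<lambda>(N, M). gain_SM \<alpha> P \<eta> \<sigma> \<Delta>t \<Delta>r D xs N M /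
            (let Lt = D / real N; Lr = D / real M in
              (1 + 2 * \<Delta>r / Lr * arctan (D / (2 * \<Delta>r))) *
              (1 + 2 * \<Delta>t / Lt * arctan (D / (2 * \<Delta>t)))))
          \<longlongrightarrow> 1)
         (inf (sequentially \<times>\<^sub>F sequentially) (principal {(N, M). odd N \<and> odd M}))"
proof -
  obtain X where X: "\<And>N. X N \<in> segment_positions D N"
      and X_max: "\<And>N y. y \<in> segment_positions D N \<Longrightarrow>
        (\<Sum>k=1..N. path_gain \<Delta>t xs (y k)) \<le> (\<Sum>k=1..N. path_gain \<Delta>t xs (X N k))"
    by (fact segment_maximizers_exist[OF \<open>D > 0\<close> continuous_on_path_gain[OF \<open>\<Delta>t > 0\<close>]])
  obtain Z where Z: "\<And>M. Z M \<in> segment_positions D M"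
      and Z_max: "\<And>M y. y \<in> segment_positions D M \<Longrightarrow>
        (\<Sum>k=1..M. path_gain \<Delta>r xs (y k)) \<le> (\<Sum>k=1..M. path_gain \<Delta>r xs (Z M k))"
    by (fact segment_maximizers_exist[OF \<open>D > 0\<close> continuous_on_path_gain[OF \<open>\<Delta>r > 0\<close>]])
  define g where "g \<Delta> Y N = \<Delta>\<^sup>2 * (\<Sum>k=1..N. path_gain \<Delta> xs (Y N k)) /
      (1 + 2 * \<Delta> / (D / real N) * arctan (D / (2 * \<Delta>)))" for \<Delta> N and Y :: "nat \<Rightarrow> nat \<Rightarrow> real"
  have "g \<Delta>t X \<longlonglongrightarrow> 1" "g \<Delta>r Z \<longlonglongrightarrow> 1"
    unfolding g_def \<open>xs = D / 2\<close> using assms X Z by (intro normalized_gain_tendsto_1; simp)+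
  hence "((\<lambda>p. g \<Delta>t X (fst p) * g \<Delta>r Z (snd p)) \<longlongrightarrow> 1 * 1) (sequentially \<times>\<^sub>F sequentially)"
    by (intro tendsto_mult filterlim_compose[OF _ filterlim_fst] filterlim_compose[OF _ filterlim_snd])
  \<comment> \<open>The limit along all pairs passes to the finer filter of odd pairs.\<close>
  hence "((\<lambda>p. g \<Delta>t X (fst p) * g \<Delta>r Z (snd p)) \<longlongrightarrow> 1)
      (inf (sequentially \<times>\<^sub>F sequentially) (principal {(N, M). odd N \<and> odd M}))"
    by (intro tendsto_mono[OF inf_le1]) simp
  moreover have "(\<lambda>(N, M). gain_SM \<alpha> P \<eta> \<sigma> \<Delta>t \<Delta>r D xs N M /
            (let Lt = D / real N; Lr = D / real M in
              (1 + 2 * \<Delta>r / Lr * arctan (D / (2 * \<Delta>r))) *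
              (1 + 2 * \<Delta>t / Lt * arctan (D / (2 * \<Delta>t))))) =
      (\<lambda>p. g \<Delta>t X (fst p) * g \<Delta>r Z (snd p))"
    by (simp only: fun_eq_iff split_paired_All case_prod_conv fst_conv snd_conv Let_def g_def
        gain_SM_eq[OF assms(2-7) X X_max Z Z_max] times_divide_times_eq mult.commute simp_thms)
  ultimately show ?thesis by simp
qed

end
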